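(* There is a unique family of homogeneous polynomials $\{\mathfrak{P}_F(\mathbf{x};\mathbf{t}) : F \text{ an indexed forest}\}\subset \mathbb{Z}[\mathbf{t}][\mathbf{x}]$ such that, writing $\widehat{\mathbf{t}}_i=(t_1,\dots,t_{i-1},t_{i+1},t_{i+2},\dots)$, for every indexed forest $F$ we have $$\mathfrak{P}_F(\mathbf{t};\mathbf{t})=\begin{cases}1 & F=\emptyset\\ 0 & \text{otherwise,}\end{cases}\qquad\text{and for every } i\ge 1:\qquad E_i\mathfrak{P}_F=\begin{cases}\mathfrak{P}_{F/i}(\mathbf{x};\widehat{\mathbf{t}}_i) & i\in \mathrm{Qdes}(F)\\ 0 & \text{otherwise.}\end{cases}$$
   Context: $\mathbf{x}=(x_1,x_2,\dots)$ and $\mathbf{t}=(t_1,t_2,\dots)$ are two infinite sets of commuting variables; homogeneity is with respect to total degree with $\deg x_i=\deg t_i=1$. $\mathfrak{P}_F(\mathbf{t};\mathbf{t})$ means substituting $x_i=t_i$ for all $i$, and $\mathfrak P_{F/i}(\mathbf x;\widehat{\mathbf t}_i)$ means substituting the sequence $\widehat{\mathbf t}_i$ for the sequence $\mathbf t$. For $f\in\mathbb Z[\mathbf t][\mathbf x]$ set $R_i^-f=f(x_1,\dots,x_{i-1},t_i,x_i,x_{i+1},\dots;\mathbf t)$, $R_i^+f=f(x_1,\dots,x_{i-1},x_i,t_i,x_{i+1},\dots;\mathbf t)$ (insert $t_i$ in position $i$, resp. $i+1$, shifting later $x$'s up), and $E_if=(R_i^+f-R_i^-f)/(x_i-t_i)$.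 Indexed forests: a binary plane tree is a rooted tree in which each node is either a leaf or an internal node with an ordered pair of children (left child, right child); the one-node tree is trivial. An indexed forest is a sequence $F=(T_1,T_2,\dots)$ of binary plane trees, all but finitely many trivial. The leaves of $F$ are identified with $\mathbb N=\{1,2,\dots\}$ from left to right across all trees in order. $\emptyset$ is the forest with all trees trivial. An internal node is terminal if both its children are leaves. For an internal node $v$, $\rho_F(v)$ is the leaf reached from $v$ by repeatedly passing to the left child. $\mathrm{Qdes}(F)=\{\rho_F(v): v\text{ terminal}\}$. For $i\in\mathrm{Qdes}(F)$, $F/i$ is the indexed forest obtained by deleting the terminal node $v$ with $\rho_F(v)=i$ (replacing $v$ and its two leaves by a single leaf, and relabeling leaves left to right by $\mathbb N$). *)

theory Defs
  imports Main "HOL-Library.Poly_Mapping"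
begin

text \<open>Indices are 0-based: X n stands for x_(n+1), T n for t_(n+1).\<close>
datatype var = X nat | T nat

type_synonym poly = "((var \<Rightarrow>\<^sub>0 nat) \<Rightarrow>\<^sub>0 int)"

definition Var :: "var \<Rightarrow> poly" where
  "Var v = Poly_Mapping.single (Poly_Mapping.single v 1) 1"

definition homogeneous :: "poly \<Rightarrow> bool" where
  "homogeneous p \<longleftrightarrow> (\<exists>d. \<forall>m\<in>Poly_Mapping.keys p. sum (Poly_Mapping.lookup m) (Poly_Mapping.keys m) = d)"

definition subst :: "(var \<Rightarrow> poly) \<Rightarrow> poly \<Rightarrow> poly" where
  "subst \<sigma> p = (\<Sum>m\<in>Poly_Mapping.keys p. of_int (Poly_Mapping.lookup p m) * (\<Prod>v\<in>Poly_Mapping.keys m. \<sigma> v ^ Poly_Mapping.lookup m v))"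

definition at_t :: "var \<Rightarrow> poly" where
  "at_t v = (case v of X j \<Rightarrow> Var (T j) | T j \<Rightarrow> Var (T j))"

definition hat_t :: "nat \<Rightarrow> var \<Rightarrow> poly" where
  "hat_t i v = (case v of X j \<Rightarrow> Var (X j)
                 | T j \<Rightarrow> (if j < i then Var (T j) else Var (T (Suc j))))"

definition Rminus_sub :: "nat \<Rightarrow> var \<Rightarrow> poly" where
  "Rminus_sub i v = (case v of
      X j \<Rightarrow> (if j < i then Var (X j) else if j = i then Var (T i) else Var (X (j - 1)))
    | T j \<Rightarrow> Var (T j))"

definition Rplus_sub :: "nat \<Rightarrow> var \<Rightarrow> poly" where
  "Rplus_sub i v = (case v of
      X j \<Rightarrow> (if j \<le> i then Var (X j) else if j = Suc i then Var (T i) else Var (X (j - 1)))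
    | T j \<Rightarrow> Var (T j))"

definition Rminus :: "nat \<Rightarrow> poly \<Rightarrow> poly" where
  "Rminus i f = subst (Rminus_sub i) f"

definition Rplus :: "nat \<Rightarrow> poly \<Rightarrow> poly" where
  "Rplus i f = subst (Rplus_sub i) f"

text \<open>E_i f = (R_i^+ f - R_i^- f) / (x_i - t_i) (exact division in Z[x,t]).\<close>
definition E :: "nat \<Rightarrow> poly \<Rightarrow> poly" where
  "E i f = (THE g. (Var (X i) - Var (T i)) * g = Rplus i f - Rminus i f)"

datatype tree = Leaf | Node tree tree

fun nleaves :: "tree \<Rightarrow> nat" where
  "nleaves Leaf = 1"
| "nleaves (Node l r) = nleaves l + nleaves r"

text \<open>Local (0-based) leaf positions rho(v) of terminal nodes v of a tree.\<close>
fun qdes_tree :: "tree \<Rightarrow> nat set" where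
  "qdes_tree Leaf = {}"
| "qdes_tree (Node l r) =
     (if l = Leaf \<and> r = Leaf then {0}
      else qdes_tree l \<union> (\<lambda>j. j + nleaves l) ` qdes_tree r)"

fun del_tree :: "nat \<Rightarrow> tree \<Rightarrow> tree" where
  "del_tree j Leaf = Leaf"
| "del_tree j (Node l r) =
     (if l = Leaf \<and> r = Leaf then Leaf
      else if j < nleaves l then Node (del_tree j l) r
      else Node l (del_tree (j - nleaves l) r))"

type_synonym forest = "nat \<Rightarrow> tree"

definition indexed_forest :: "forest \<Rightarrow> bool" where
  "indexed_forest F \<longleftrightarrow> finite {k. F k \<noteq> Leaf}"

definition empty_forest :: forest where
  "empty_forest = (\<lambda>_. Leaf)"

text \<open>Global label (0-based) of the first leaf of tree k.\<close>
definition offset :: "forest \<Rightarrow> nat \<Rightarrow> nat" where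
  "offset F k = (\<Sum>j<k. nleaves (F j))"

definition Qdes :: "forest \<Rightarrow> nat set" where
  "Qdes F = (\<Union>k. (\<lambda>j. j + offset F k) ` qdes_tree (F k))"

definition forest_del :: "forest \<Rightarrow> nat \<Rightarrow> forest" where
  "forest_del F i = (\<lambda>k. if offset F k \<le> i \<and> i < offset F (Suc k)
                         then del_tree (i - offset F k) (F k) else F k)"

end

theory Submission
  imports Defs "HOL-Library.Countable"
begin

text \<open>
  The operators satisfy E_j E_i = E_i E_(j+1) for i < j, where the left E_j is taken in the
  alphabet without t_i and the right E_i in the alphabet without t_(j+1). This is the only
  obstruction to integration: a family (g_i), almost all zero, that satisfies the corresponding
  relations consists of the derivatives E_i f of some f. Moreover f is determined by its
  derivatives and its value at x = t, because a polynomial killed by all E_i involves no x.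

  Let F.i be the forest in which leaf i of F has become a terminal node, so that i belongs to
  Qdes(F.i) and (F.i)/i = F. The identity (F.i).(j+1) = (F.j).i for i < j matches the relation
  between the operators. Hence the derivatives prescribed for the polynomial of F can be
  integrated once the polynomials of all F/i are known.
\<close>

section \<open>Polynomials and substitution\<close>

text \<open>An arbitrary linear order on the variables makes the polynomial ring an integral domain.\<close>

instance var :: countable
  by countable_datatype

instantiation var :: linorder
begin

definition less_eq_var :: "var \<Rightarrow> var \<Rightarrow> bool" where
  "less_eq_var v w \<longleftrightarrow> to_nat v \<le> to_nat w"

definition less_var :: "var \<Rightarrow> var \<Rightarrow> bool" where
  "less_var v w \<longleftrightarrow> to_nat v < to_nat w"

instance
  by standard (auto simp: less_eq_var_def less_var_def)

end

definition monom_degree :: "('a \<Rightarrow>\<^sub>0 nat) \<Rightarrow> nat" where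
  "monom_degree m = sum (Poly_Mapping.lookup m) (Poly_Mapping.keys m)"

lemma keys_add_nat:
  fixes m n :: "'a \<Rightarrow>\<^sub>0 nat"
  shows "Poly_Mapping.keys (m + n) = Poly_Mapping.keys m \<union> Poly_Mapping.keys n"
  by (auto simp: in_keys_iff lookup_add)

lemma monom_degree_zero [simp]: "monom_degree 0 = 0"
  by (simp add: monom_degree_def)

lemma monom_degree_add: "monom_degree (m + n) = monom_degree m + monom_degree n"
  unfolding monom_degree_def by (rule setsum_keys_plus_distrib) auto

lemma monom_degree_single [simp]: "monom_degree (Poly_Mapping.single v k) = k"
  by (simp add: monom_degree_def)

lemma monom_degree_eq_0_iff: "monom_degree m = 0 \<longleftrightarrow> m = 0"
proof
  assume "monom_degree m = 0"
  then have "\<forall>v\<in>Poly_Mapping.keys m. Poly_Mapping.lookup m v = 0"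
    by (simp add: monom_degree_def)
  then have "Poly_Mapping.keys m = {}"
    by blast
  then show "m = 0"
    by simp
qed simp

lemma monom_induct [case_names zero Var]:
  assumes "P 0" and step: "\<And>v m. P m \<Longrightarrow> P (Poly_Mapping.single v 1 + m)"
  shows "P (m :: 'a \<Rightarrow>\<^sub>0 nat)"
proof (induction "monom_degree m" arbitrary: m)
  case 0
  then show ?case
    using \<open>P 0\<close> by (simp add: monom_degree_eq_0_iff)
next
  case (Suc n)
  then have "m \<noteq> 0"
    by auto
  then obtain v where "Poly_Mapping.lookup m v \<noteq> 0"
    by (metis lookup_zero poly_mapping_eqI)
  then have m: "m = Poly_Mapping.single v 1 + (m - Poly_Mapping.single v 1)"
    by (intro poly_mapping_eqI) (auto simp: lookup_add lookup_minus lookup_single when_def)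
  then have "monom_degree m = 1 + monom_degree (m - Poly_Mapping.single v 1)"
    by (metis monom_degree_add monom_degree_single)
  then have "P (m - Poly_Mapping.single v 1)"
    using Suc by simp
  then show ?case
    using step m by metis
qed

definition subst_monom :: "(var \<Rightarrow> poly) \<Rightarrow> (var \<Rightarrow>\<^sub>0 nat) \<Rightarrow> poly" where
  "subst_monom \<sigma> m = (\<Prod>v\<in>Poly_Mapping.keys m. \<sigma> v ^ Poly_Mapping.lookup m v)"

lemma subst_monom_zero [simp]: "subst_monom \<sigma> 0 = 1"
  by (simp add: subst_monom_def)

lemma subst_monom_single [simp]: "subst_monom \<sigma> (Poly_Mapping.single v k) = \<sigma> v ^ k"
  by (simp add: subst_monom_def)

lemma subst_monom_add: "subst_monom \<sigma> (m + n) = subst_monom \<sigma> m * subst_monom \<sigma> n"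
proof -
  let ?K = "Poly_Mapping.keys m \<union> Poly_Mapping.keys n"
  have "subst_monom \<sigma> k = (\<Prod>v\<in>?K. \<sigma> v ^ Poly_Mapping.lookup k v)"
    if "Poly_Mapping.keys k \<subseteq> ?K" for k
    unfolding subst_monom_def
    by (rule prod.mono_neutral_left) (use that in \<open>auto simp: in_keys_iff\<close>)
  then show ?thesis
    by (simp add: keys_add_nat lookup_add power_add prod.distrib)
qed

lemma frag_cmul_eq_of_int_mult:
  "frag_cmul c p = of_int c * (p :: 'a::monoid_add \<Rightarrow>\<^sub>0 int)"
proof -
  have "frag_cmul c p = Poly_Mapping.map ((*) c) p"
    by (rule poly_mapping_eqI) (simp add: Poly_Mapping.map.rep_eq when_def)
  then show ?thesis
    by (simp only: mult_map_scale_conv_mult flip: single_of_int) simp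
qed

text \<open>
  As an additive group the polynomial ring is free on the monomials, so the theory of
  \<^const>\<open>frag_extend\<close> and the induction rule \<open>frag_induction\<close> apply to it.
\<close>

lemma subst_eq_frag_extend: "subst \<sigma> = frag_extend (subst_monom \<sigma>)"
  by (simp add: fun_eq_iff subst_def frag_extend_def subst_monom_def frag_cmul_eq_of_int_mult)

lemma frag_of_add: "frag_of (m + n) = frag_of m * frag_of n"
  by (simp add: mult_single)

lemma Var_eq_frag_of: "Var v = frag_of (Poly_Mapping.single v 1)"
  by (simp add: Var_def)

lemma Var_eq_iff [simp]: "Var v = Var w \<longleftrightarrow> v = w"
  unfolding Var_eq_frag_of frag_of_eq
  by (metis keys_single one_neq_zero singleton_inject)

lemma subst_frag_of: "subst \<sigma> (frag_of m) = subst_monom \<sigma> m"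
  by (simp add: subst_eq_frag_extend)

lemma subst_zero [simp]: "subst \<sigma> 0 = 0"
  by (simp add: subst_eq_frag_extend)

lemma subst_one [simp]: "subst \<sigma> 1 = 1"
  using subst_frag_of[of \<sigma> 0] by simp

lemma subst_Var [simp]: "subst \<sigma> (Var v) = \<sigma> v"
  by (simp add: Var_eq_frag_of subst_frag_of)

lemma subst_diff: "subst \<sigma> (p - q) = subst \<sigma> p - subst \<sigma> q"
  by (simp add: subst_eq_frag_extend frag_extend_diff)

lemma subst_frag_of_mult: "subst \<sigma> (frag_of m * q) = subst_monom \<sigma> m * subst \<sigma> q"
proof (induction rule: frag_induction[OF subset_UNIV, of _ q])
  case (2 n)
  show ?case
    by (simp only: subst_frag_of subst_monom_add flip: frag_of_add)
qed (simp_all add: right_diff_distrib subst_diff)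

lemma subst_mult: "subst \<sigma> (p * q) = subst \<sigma> p * subst \<sigma> q"
proof (induction rule: frag_induction[OF subset_UNIV, of _ p])
  case (2 m)
  show ?case
    by (simp only: subst_frag_of_mult subst_frag_of)
qed (simp_all add: left_diff_distrib subst_diff)

lemma poly_induct [case_names one Var diff]:
  assumes "P 1" and Var: "\<And>v p. P p \<Longrightarrow> P (Var v * p)" and diff: "\<And>p q. P p \<Longrightarrow> P q \<Longrightarrow> P (p - q)"
  shows "P (p :: poly)"
proof -
  have "P (frag_of m)" for m
  proof (induction m rule: monom_induct)
    case zero
    then show ?case
      using \<open>P 1\<close> by simp
  next
    case (Var v m)
    then show ?case
      by (simp only: assms(2) frag_of_add flip: Var_eq_frag_of)
  qed
  moreover have "P 0"
    using diff[OF \<open>P 1\<close> \<open>P 1\<close>] by simp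
  ultimately show ?thesis
    by (induction rule: frag_induction[OF subset_UNIV, of _ p]) (simp_all only: diff)
qed

lemma subst_subst: "subst \<sigma> (subst \<tau> p) = subst (\<lambda>v. subst \<sigma> (\<tau> v)) p"
  by (induction p rule: poly_induct) (auto simp: subst_diff subst_mult)

lemma subst_commuteI:
  assumes "\<And>v. subst \<sigma> (\<tau> v) = subst \<sigma>' (\<tau>' v)"
  shows "subst \<sigma> (subst \<tau> p) = subst \<sigma>' (subst \<tau>' p)"
  by (simp add: subst_subst assms)

lemma dvd_subst_diff:
  assumes "\<And>v. q dvd \<sigma> v - \<tau> v"
  shows "q dvd subst \<sigma> p - subst \<tau> p"
proof (induction p rule: poly_induct)
  case (Var v p)
  have "subst \<sigma> (Var v * p) - subst \<tau> (Var v * p)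
      = (\<sigma> v - \<tau> v) * subst \<sigma> p + \<tau> v * (subst \<sigma> p - subst \<tau> p)"
    by (simp add: subst_mult algebra_simps)
  then show ?case
    using assms[of v] Var by (simp add: dvd_add dvd_mult dvd_mult2)
next
  case (diff p1 p2)
  have "subst \<sigma> (p1 - p2) - subst \<tau> (p1 - p2)
      = (subst \<sigma> p1 - subst \<tau> p1) - (subst \<sigma> p2 - subst \<tau> p2)"
    by (simp add: subst_diff)
  then show ?case
    using diff by (simp add: dvd_diff)
qed simp

definition vars :: "(('a \<Rightarrow>\<^sub>0 nat) \<Rightarrow>\<^sub>0 'b::zero) \<Rightarrow> 'a set" where
  "vars p = (\<Union>m\<in>Poly_Mapping.keys p. Poly_Mapping.keys m)"

lemma finite_vars [simp]: "finite (vars p)"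
  by (simp add: vars_def)

lemma vars_one [simp]: "vars (1 :: ('a \<Rightarrow>\<^sub>0 nat) \<Rightarrow>\<^sub>0 'b::zero_neq_one) = {}"
  by (simp add: vars_def)

lemma vars_Var [simp]: "vars (Var v) = {v}"
  by (simp add: vars_def Var_def)

lemma vars_diff:
  fixes p q :: "('a \<Rightarrow>\<^sub>0 nat) \<Rightarrow>\<^sub>0 'b::cancel_comm_monoid_add"
  shows "vars (p - q) \<subseteq> vars p \<union> vars q"
  using keys_diff[of p q] by (fastforce simp: vars_def)

lemma vars_mult:
  fixes p q :: "('a \<Rightarrow>\<^sub>0 nat) \<Rightarrow>\<^sub>0 'b::semiring_0"
  shows "vars (p * q) \<subseteq> vars p \<union> vars q"
  using keys_mult[of p q] by (fastforce simp: vars_def keys_add_nat)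

lemma vars_subst_monom: "vars (subst_monom \<sigma> m) \<subseteq> (\<Union>v\<in>Poly_Mapping.keys m. vars (\<sigma> v))"
proof (induction m rule: monom_induct)
  case (Var v m)
  have "vars (subst_monom \<sigma> (Poly_Mapping.single v 1 + m)) \<subseteq> vars (\<sigma> v) \<union> vars (subst_monom \<sigma> m)"
    unfolding subst_monom_add using vars_mult by simp
  then show ?case
    using Var by (auto simp: keys_add_nat)
qed simp

lemma vars_subst: "vars (subst \<sigma> p) \<subseteq> (\<Union>v\<in>vars p. vars (\<sigma> v))"
proof -
  have "Poly_Mapping.keys (subst \<sigma> p)
      \<subseteq> (\<Union>m\<in>Poly_Mapping.keys p. Poly_Mapping.keys (subst_monom \<sigma> m))"
    unfolding subst_eq_frag_extend by (rule keys_frag_extend)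
  then have "vars (subst \<sigma> p) \<subseteq> (\<Union>m\<in>Poly_Mapping.keys p. vars (subst_monom \<sigma> m))"
    unfolding vars_def by blast
  also have "\<dots> \<subseteq> (\<Union>m\<in>Poly_Mapping.keys p. \<Union>v\<in>Poly_Mapping.keys m. vars (\<sigma> v))"
    by (intro UN_mono order_refl vars_subst_monom)
  also have "\<dots> = (\<Union>v\<in>vars p. vars (\<sigma> v))"
    by (simp add: vars_def[of p])
  finally show ?thesis .
qed

lemma subst_cong: "(\<And>v. v \<in> vars p \<Longrightarrow> \<sigma> v = \<tau> v) \<Longrightarrow> subst \<sigma> p = subst \<tau> p"
  unfolding subst_def vars_def
  by (intro sum.cong refl arg_cong2[of _ _ _ _ "(*)"] prod.cong) (metis UN_I)

lemma subst_Var_id [simp]: "subst Var p = p"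
  by (induction p rule: poly_induct) (simp_all add: subst_mult subst_diff)

lemma subst_id_if_fixes_vars: "(\<And>v. v \<in> vars p \<Longrightarrow> \<sigma> v = Var v) \<Longrightarrow> subst \<sigma> p = p"
  using subst_cong[of p \<sigma> Var] by simp

definition homogeneous_deg :: "nat \<Rightarrow> (('a \<Rightarrow>\<^sub>0 nat) \<Rightarrow>\<^sub>0 'b::zero) \<Rightarrow> bool" where
  "homogeneous_deg d p \<longleftrightarrow> (\<forall>m\<in>Poly_Mapping.keys p. monom_degree m = d)"

lemma homogeneous_iff: "homogeneous p \<longleftrightarrow> (\<exists>d. homogeneous_deg d p)"
  by (simp add: homogeneous_def homogeneous_deg_def monom_degree_def)

lemma homogeneous_deg_zero [simp]: "homogeneous_deg d 0"
  by (simp add: homogeneous_deg_def)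

lemma homogeneous_deg_one [simp]:
  "homogeneous_deg 0 (1 :: ('a \<Rightarrow>\<^sub>0 nat) \<Rightarrow>\<^sub>0 'b::zero_neq_one)"
  by (simp add: homogeneous_deg_def)

lemma homogeneous_deg_Var [simp]: "homogeneous_deg (Suc 0) (Var v)"
  by (simp add: homogeneous_deg_def Var_def)

lemma homogeneous_deg_diff:
  fixes p q :: "('a \<Rightarrow>\<^sub>0 nat) \<Rightarrow>\<^sub>0 'b::cancel_comm_monoid_add"
  assumes "homogeneous_deg d p" "homogeneous_deg d q"
  shows "homogeneous_deg d (p - q)"
  using assms keys_diff[of p q] by (fastforce simp: homogeneous_deg_def)

lemma homogeneous_deg_mult:
  fixes p q :: "('a \<Rightarrow>\<^sub>0 nat) \<Rightarrow>\<^sub>0 'b::semiring_0"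
  assumes "homogeneous_deg d p" "homogeneous_deg e q"
  shows "homogeneous_deg (d + e) (p * q)"
  using assms keys_mult[of p q] by (fastforce simp: homogeneous_deg_def monom_degree_add)

lemma homogeneous_deg_subst_monom:
  assumes "\<And>v. homogeneous_deg (Suc 0) (\<sigma> v)"
  shows "homogeneous_deg (monom_degree m) (subst_monom \<sigma> m)"
proof (induction m rule: monom_induct)
  case (Var v m)
  then show ?case
    using homogeneous_deg_mult[OF assms, of _ _ v]
    by (simp add: subst_monom_add monom_degree_add)
qed simp

lemma homogeneous_deg_subst:
  assumes "\<And>v. homogeneous_deg (Suc 0) (\<sigma> v)" and "homogeneous_deg d p"
  shows "homogeneous_deg d (subst \<sigma> p)"
  using keys_frag_extend[of "subst_monom \<sigma>" p] homogeneous_deg_subst_monom[OF assms(1)] assms(2)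
  unfolding homogeneous_deg_def subst_eq_frag_extend by fastforce

definition homogeneous_part :: "nat \<Rightarrow> (('a \<Rightarrow>\<^sub>0 nat) \<Rightarrow>\<^sub>0 int) \<Rightarrow> ('a \<Rightarrow>\<^sub>0 nat) \<Rightarrow>\<^sub>0 int" where
  "homogeneous_part d = frag_extend (\<lambda>m. if monom_degree m = d then frag_of m else 0)"

lemma homogeneous_deg_homogeneous_part: "homogeneous_deg d (homogeneous_part d p)"
  using keys_frag_extend[of _ p]
  unfolding homogeneous_deg_def homogeneous_part_def by (fastforce split: if_splits)

lemma homogeneous_part_id:
  assumes "homogeneous_deg d p"
  shows "homogeneous_part d p = p"
proof -
  have "homogeneous_part d p = frag_extend frag_of p"
    unfolding homogeneous_part_def
    using assms by (intro frag_extend_eq) (simp add: homogeneous_deg_def)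
  then show ?thesis
    by (simp flip: frag_expansion)
qed

lemma homogeneous_part_frag_of_mult:
  "homogeneous_part (monom_degree m + d) (frag_of m * p) = frag_of m * homogeneous_part d p"
proof (induction rule: frag_induction[OF subset_UNIV, of _ p])
  case (2 n)
  then show ?case
    by (simp add: homogeneous_part_def monom_degree_add flip: frag_of_add)
qed (simp_all add: homogeneous_part_def right_diff_distrib frag_extend_diff)

lemma homogeneous_part_mult:
  assumes "homogeneous_deg e q"
  shows "homogeneous_part (e + d) (q * p) = q * homogeneous_part d p"
proof -
  have "Poly_Mapping.keys q \<subseteq> {m. monom_degree m = e}"
    using assms by (auto simp: homogeneous_deg_def)
  then show ?thesis
  proof (induction rule: frag_induction)
    case (one m)
    then show ?case
      using homogeneous_part_frag_of_mult by blast
  qed (simp_all add: homogeneous_part_def left_diff_distrib frag_extend_diff)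
qed

lemma homogeneous_deg_cancel_left:
  fixes q p :: "('a::linorder \<Rightarrow>\<^sub>0 nat) \<Rightarrow>\<^sub>0 int"
  assumes "homogeneous_deg (e + d) (q * p)" "homogeneous_deg e q" "q \<noteq> 0"
  shows "homogeneous_deg d p"
proof -
  have "q * homogeneous_part d p = q * p"
    using homogeneous_part_id[OF assms(1)] homogeneous_part_mult[OF assms(2)] by simp
  then have "homogeneous_part d p = p"
    using \<open>q \<noteq> 0\<close> by simp
  then show ?thesis
    using homogeneous_deg_homogeneous_part[of d p] by simp
qed

section \<open>Divided differences\<close>

text \<open>
  R_i^- and R_i^+ insert t_i in positions i and i + 1. Inserting any T k in any position p covers
  both, and also the operators of the alphabets \<^const>\<open>hat_t\<close>, whose i-th letter need not be T i.
\<close>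

fun insert_T :: "nat \<Rightarrow> nat \<Rightarrow> var \<Rightarrow> poly" where
  "insert_T p k (X j) =
     (if j < p then Var (X j) else if j = p then Var (T k) else Var (X (j - 1)))"
| "insert_T p k (T j) = Var (T j)"

definition divdiff :: "nat \<Rightarrow> nat \<Rightarrow> poly \<Rightarrow> poly" where
  "divdiff j k f = (THE g. (Var (X j) - Var (T k)) * g
     = subst (insert_T (Suc j) k) f - subst (insert_T j k) f)"

lemma E_eq_divdiff: "E i = divdiff i i"
proof -
  have "Rplus_sub i = insert_T (Suc i) i" "Rminus_sub i = insert_T i i"
    by (auto simp: fun_eq_iff Rplus_sub_def Rminus_sub_def split: var.split)
  then show ?thesis
    by (intro ext) (simp add: E_def divdiff_def Rplus_def Rminus_def)
qed

lemma subst_insert_T_id: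
  assumes "X -` vars f \<subseteq> {..<p}"
  shows "subst (insert_T p k) f = f"
proof (rule subst_id_if_fixes_vars)
  fix v assume "v \<in> vars f"
  then show "insert_T p k v = Var v"
    using assms by (cases v) auto
qed

lemma subst_insert_T_commute:
  assumes "p \<le> q"
  shows "subst (insert_T q k) (subst (insert_T p l) f)
    = subst (insert_T p l) (subst (insert_T (Suc q) k) f)"
proof (rule subst_commuteI)
  fix v
  show "subst (insert_T q k) (insert_T p l v) = subst (insert_T p l) (insert_T (Suc q) k v)"
    using assms by (cases v) auto
qed

lemma homogeneous_deg_insert_T: "homogeneous_deg (Suc 0) (insert_T p k v)"
  by (cases v) auto

lemma divdiff_eqI:
  assumes "(Var (X j) - Var (T k)) * g = subst (insert_T (Suc j) k) f - subst (insert_T j k) f"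
  shows "divdiff j k f = g"
  unfolding divdiff_def
proof (rule the_equality)
  fix h
  assume "(Var (X j) - Var (T k)) * h = subst (insert_T (Suc j) k) f - subst (insert_T j k) f"
  then have "(Var (X j) - Var (T k)) * h = (Var (X j) - Var (T k)) * g"
    using assms by simp
  then show "h = g"
    by simp
qed (rule assms)

lemma mult_divdiff:
  "(Var (X j) - Var (T k)) * divdiff j k f = subst (insert_T (Suc j) k) f - subst (insert_T j k) f"
proof -
  have "Var (X j) - Var (T k) dvd insert_T (Suc j) k v - insert_T j k v" for v
  proof (cases "v = X (Suc j)")
    case True
    have "Var (X j) - Var (T k) dvd Var (T k) - Var (X j)"
      by (metis dvd_minus_iff dvd_refl minus_diff_eq)
    then show ?thesis
      using True by simp
  next
    case False
    then show ?thesis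
      by (cases v) auto
  qed
  then obtain g where "subst (insert_T (Suc j) k) f - subst (insert_T j k) f
      = (Var (X j) - Var (T k)) * g"
    using dvd_subst_diff by blast
  then show ?thesis
    using divdiff_eqI[of j k g f] by simp
qed

lemma homogeneous_deg_divdiff:
  assumes "homogeneous_deg (Suc d) f"
  shows "homogeneous_deg d (divdiff j k f)"
proof (rule homogeneous_deg_cancel_left)
  show "homogeneous_deg (Suc 0 + d) ((Var (X j) - Var (T k)) * divdiff j k f)"
    using assms homogeneous_deg_insert_T
    by (auto simp: mult_divdiff intro!: homogeneous_deg_diff homogeneous_deg_subst)
qed (auto intro: homogeneous_deg_diff)

lemma divdiff_diff: "divdiff j k (f - g) = divdiff j k f - divdiff j k g"
  by (rule divdiff_eqI) (simp add: right_diff_distrib[of "_ - _"] mult_divdiff subst_diff)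

lemma divdiff_eq_0_iff:
  "divdiff j k f = 0 \<longleftrightarrow> subst (insert_T (Suc j) k) f = subst (insert_T j k) f"
  using mult_divdiff[of j k f] by (auto intro: divdiff_eqI)

lemma divdiff_mult_left:
  assumes "X -` vars q \<subseteq> {..<j}"
  shows "divdiff j k (q * f) = q * divdiff j k f"
proof (rule divdiff_eqI)
  have "X -` vars q \<subseteq> {..<Suc j}"
    using assms by auto
  then show "(Var (X j) - Var (T k)) * (q * divdiff j k f)
      = subst (insert_T (Suc j) k) (q * f) - subst (insert_T j k) (q * f)"
    using assms
    by (simp add: subst_mult subst_insert_T_id mult.left_commute mult_divdiff
        right_diff_distrib[of q])
qed

lemma divdiff_eq_0_if_vars:
  assumes "X -` vars f \<subseteq> {..<j}"
  shows "divdiff j k f = 0"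
  using divdiff_mult_left[OF assms, of k 1] divdiff_eq_0_iff[of j k 1] by simp

lemma divdiff_top:
  assumes "X -` vars g \<subseteq> {..j}"
  shows "divdiff j k ((Var (X j) - Var (T k)) * g) = g"
proof (rule divdiff_eqI)
  have "subst (insert_T (Suc j) k) g = g"
    using assms by (intro subst_insert_T_id) auto
  then show "(Var (X j) - Var (T k)) * g
      = subst (insert_T (Suc j) k) ((Var (X j) - Var (T k)) * g)
        - subst (insert_T j k) ((Var (X j) - Var (T k)) * g)"
    by (simp add: subst_mult subst_diff)
qed

lemma divdiff_above_top:
  assumes "X -` vars g \<subseteq> {..j}" "j < i"
  shows "divdiff i l ((Var (X j) - Var (T k)) * g) = 0"
proof (rule divdiff_eq_0_if_vars)
  have "vars ((Var (X j) - Var (T k)) * g) \<subseteq> {X j, T k} \<union> vars g"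
    using vars_mult[of "Var (X j) - Var (T k)" g] vars_diff[of "Var (X j)" "Var (T k)"] by auto
  then have "X -` vars ((Var (X j) - Var (T k)) * g) \<subseteq> insert j (X -` vars g)"
    by auto
  then show "X -` vars ((Var (X j) - Var (T k)) * g) \<subseteq> {..<i}"
    using assms by fastforce
qed

lemma divdiff_subst:
  assumes "\<sigma> (X j') = Var (X j)" "\<sigma> (T k') = Var (T k)"
    and "\<And>v. subst (insert_T j k) (\<sigma> v) = subst \<sigma> (insert_T j' k' v)"
    and "\<And>v. subst (insert_T (Suc j) k) (\<sigma> v) = subst \<sigma> (insert_T (Suc j') k' v)"
  shows "divdiff j k (subst \<sigma> f) = subst \<sigma> (divdiff j' k' f)"
proof (rule divdiff_eqI)
  have "(Var (X j) - Var (T k)) * subst \<sigma> (divdiff j' k' f)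
      = subst \<sigma> ((Var (X j') - Var (T k')) * divdiff j' k' f)"
    using assms(1,2) by (simp add: subst_mult subst_diff)
  also have "\<dots> = subst \<sigma> (subst (insert_T (Suc j') k') f) - subst \<sigma> (subst (insert_T j' k') f)"
    unfolding mult_divdiff by (rule subst_diff)
  also have "\<dots> = subst (insert_T (Suc j) k) (subst \<sigma> f) - subst (insert_T j k) (subst \<sigma> f)"
    by (simp add: subst_commuteI[of _ \<sigma>, OF assms(3)] subst_commuteI[of _ \<sigma>, OF assms(4)])
  finally show "(Var (X j) - Var (T k)) * subst \<sigma> (divdiff j' k' f)
      = subst (insert_T (Suc j) k) (subst \<sigma> f) - subst (insert_T j k) (subst \<sigma> f)" .
qed

lemma divdiff_subst_insert_T:
  assumes "p \<le> j"
  shows "divdiff j k (subst (insert_T p l) f) = subst (insert_T p l) (divdiff (Suc j) k f)"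
proof (rule divdiff_subst)
  have "subst (insert_T q k) (insert_T p l v) = subst (insert_T p l) (insert_T (Suc q) k v)"
    if "p \<le> q" for q v
    using subst_insert_T_commute[OF that, of k l "Var v"] by simp
  then show "subst (insert_T j k) (insert_T p l v) = subst (insert_T p l) (insert_T (Suc j) k v)"
    "subst (insert_T (Suc j) k) (insert_T p l v) = subst (insert_T p l) (insert_T (Suc (Suc j)) k v)"
    for v
    using assms by simp_all
qed (use assms in auto)

lemma divdiff_commute:
  assumes "i < j"
  shows "divdiff j k (divdiff i l f) = divdiff i l (divdiff (Suc j) k f)"
proof -
  let ?q = "Var (X i) - Var (T l)"
  have "X -` vars ?q \<subseteq> {..<j}"
    using vars_diff[of "Var (X i)" "Var (T l)"] assms by auto
  then have "?q * divdiff j k (divdiff i l f) = divdiff j k (?q * divdiff i l f)"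
    by (simp add: divdiff_mult_left)
  also have "\<dots> = subst (insert_T (Suc i) l) (divdiff (Suc j) k f)
      - subst (insert_T i l) (divdiff (Suc j) k f)"
    using assms by (simp add: mult_divdiff divdiff_diff divdiff_subst_insert_T)
  also have "\<dots> = ?q * divdiff i l (divdiff (Suc j) k f)"
    by (simp add: mult_divdiff)
  finally show ?thesis
    by simp
qed

definition hat_index :: "nat \<Rightarrow> nat \<Rightarrow> nat" where
  "hat_index i k = (if k < i then k else Suc k)"

lemma hat_t_simps [simp]:
  "hat_t i (X j) = Var (X j)"
  "hat_t i (T j) = Var (T (hat_index i j))"
  by (simp_all add: hat_t_def hat_index_def)

lemma homogeneous_deg_hat_t: "homogeneous_deg (Suc 0) (hat_t i v)"
  by (cases v) simp_all

lemma divdiff_hat_t: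
  "divdiff j (hat_index i k) (subst (hat_t i) f) = subst (hat_t i) (divdiff j k f)"
proof (rule divdiff_subst)
  have "subst (insert_T p (hat_index i k)) (hat_t i v) = subst (hat_t i) (insert_T p k v)" for p v
    by (cases v) auto
  then show "subst (insert_T j (hat_index i k)) (hat_t i v) = subst (hat_t i) (insert_T j k v)"
    "subst (insert_T (Suc j) (hat_index i k)) (hat_t i v) = subst (hat_t i) (insert_T (Suc j) k v)"
    for v
    by blast+
qed auto

lemma hat_t_commute:
  assumes "i \<le> j"
  shows "subst (hat_t i) (subst (hat_t j) f) = subst (hat_t (Suc j)) (subst (hat_t i) f)"
proof (rule subst_commuteI)
  fix v
  show "subst (hat_t i) (hat_t j v) = subst (hat_t (Suc j)) (hat_t i v)"
    using assms by (cases v) (auto simp: hat_index_def)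
qed

text \<open>R_M^+ fixes f if x_M is its last variable, whereas R_M^- eliminates x_M.\<close>

lemma X_vars_bounded_if_divdiff_eq_0:
  assumes "\<And>j. j \<ge> n \<Longrightarrow> divdiff j (k j) f = 0"
  shows "X -` vars f \<subseteq> {..<n}"
proof (rule ccontr)
  assume "\<not> X -` vars f \<subseteq> {..<n}"
  then obtain m where m: "X m \<in> vars f" "n \<le> m"
    by (auto simp: subset_iff not_less)
  have fin: "finite (X -` vars f)"
    by (simp add: finite_vimageI inj_def)
  define M where "M = Max (X -` vars f)"
  have M_in: "X M \<in> vars f"
    using Max_in[OF fin] m(1) by (auto simp: M_def)
  have M_ge: "i \<le> M" if "X i \<in> vars f" for i
    using Max_ge[OF fin] that by (simp add: M_def)
  have "n \<le> M"
    using M_ge[OF m(1)] m(2) by simp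
  then have "subst (insert_T M (k M)) f = subst (insert_T (Suc M) (k M)) f"
    using assms[of M] by (simp add: divdiff_eq_0_iff)
  also have "\<dots> = f"
    using M_ge by (intro subst_insert_T_id) (auto simp: less_Suc_eq_le)
  finally have "X M \<in> (\<Union>v\<in>vars f. vars (insert_T M (k M) v))"
    using M_in vars_subst[of "insert_T M (k M)" f] by auto
  then obtain v where "v \<in> vars f" "X M \<in> vars (insert_T M (k M) v)"
    by blast
  then show False
    using M_ge by (cases v) (force split: if_splits)+
qed

text \<open>
  The polynomial h = (X n - T n) * g n has the derivative g n at n and none at larger indices, so
  the differences between its derivatives and g form a shorter compatible family.
\<close>

lemma divdiff_integrable:
  assumes "\<And>i. i \<ge> n \<Longrightarrow> g i = 0"
    and "\<And>i j. i < j \<Longrightarrow> divdiff j (Suc j) (g i) = divdiff i i (g (Suc j))"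
    and "\<And>i. homogeneous_deg d (g i)"
  shows "\<exists>f. homogeneous_deg (Suc d) f \<and> (\<forall>i. divdiff i i f = g i)"
  using assms
proof (induction n arbitrary: g)
  case 0
  then show ?case
    by (intro exI[of _ 0]) (simp add: divdiff_eq_0_iff)
next
  case (Suc n)
  define h where "h = (Var (X n) - Var (T n)) * g n"
  have hom_h: "homogeneous_deg (Suc d) h"
    using homogeneous_deg_mult[OF homogeneous_deg_diff Suc.prems(3),
        of "Suc 0" "Var (X n)" "Var (T n)" n]
    by (simp add: h_def)
  have "divdiff j (Suc j) (g n) = 0" if "j \<ge> Suc n" for j
    using that Suc.prems(1,2) by (simp add: divdiff_eq_0_iff)
  then have vars_gn: "X -` vars (g n) \<subseteq> {..n}"
    using X_vars_bounded_if_divdiff_eq_0[of "Suc n" Suc] by (simp add: lessThan_Suc_atMost)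
  have h_n: "divdiff n n h = g n"
    unfolding h_def using vars_gn by (rule divdiff_top)
  have h_gt: "divdiff i i h = 0" if "i > n" for i
    unfolding h_def using vars_gn that by (rule divdiff_above_top)
  have "\<exists>f. homogeneous_deg (Suc d) f \<and> (\<forall>i. divdiff i i f = divdiff i i h - g i)"
  proof (rule Suc.IH)
    show "divdiff i i h - g i = 0" if "i \<ge> n" for i
      using that h_n h_gt Suc.prems(1) by (cases "i = n") auto
    show "homogeneous_deg d (divdiff i i h - g i)" for i
      using hom_h Suc.prems(3) by (intro homogeneous_deg_diff homogeneous_deg_divdiff)
    show "divdiff j (Suc j) (divdiff i i h - g i)
        = divdiff i i (divdiff (Suc j) (Suc j) h - g (Suc j))" if "i < j" for i j
      using that by (simp add: divdiff_diff divdiff_commute Suc.prems(2))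
  qed
  then obtain f where "homogeneous_deg (Suc d) f" "\<And>i. divdiff i i f = divdiff i i h - g i"
    by blast
  then show ?case
    using hom_h by (intro exI[of _ "h - f"]) (simp add: divdiff_diff homogeneous_deg_diff)
qed

lemma homogeneous_deg_at_t: "homogeneous_deg (Suc 0) (at_t v)"
  by (cases v) (simp_all add: at_t_def)

lemma X_vars_at_t: "X -` vars (subst at_t f) = {}"
proof -
  have "X m \<notin> vars (at_t v)" for m v
    by (cases v) (simp_all add: at_t_def)
  then show ?thesis
    using vars_subst[of at_t f] by blast
qed

lemma subst_at_t_id: "X -` vars f = {} \<Longrightarrow> subst at_t f = f"
  by (rule subst_id_if_fixes_vars) (auto simp: at_t_def split: var.split)

lemma E_integrable:
  assumes "finite {i. g i \<noteq> 0}"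
    and "\<And>i j. i < j \<Longrightarrow> divdiff j (Suc j) (g i) = divdiff i i (g (Suc j))"
    and "\<And>i. homogeneous_deg d (g i)"
  obtains f where "homogeneous_deg (Suc d) f" "subst at_t f = 0" "\<And>i. E i f = g i"
proof -
  obtain n where "\<And>i. i \<ge> n \<Longrightarrow> g i = 0"
    using assms(1) unfolding finite_nat_set_iff_bounded by (metis mem_Collect_eq not_less)
  then obtain f where f: "homogeneous_deg (Suc d) f" "\<And>i. divdiff i i f = g i"
    using divdiff_integrable[of n g d] assms(2,3) by blast
  show thesis
  proof (rule that)
    show "homogeneous_deg (Suc d) (f - subst at_t f)"
      using f(1) homogeneous_deg_at_t by (intro homogeneous_deg_diff homogeneous_deg_subst)
    show "subst at_t (f - subst at_t f) = 0"
      by (simp add: subst_diff subst_at_t_id X_vars_at_t)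
    show "E i (f - subst at_t f) = g i" for i
      by (simp add: E_eq_divdiff divdiff_diff f(2) divdiff_eq_0_if_vars X_vars_at_t)
  qed
qed

lemma eq_if_E_eq:
  assumes "\<And>i. E i f = E i g" and "subst at_t f = subst at_t g"
  shows "f = g"
proof -
  have "divdiff i i (f - g) = 0" for i
    using assms(1)[of i] by (simp add: divdiff_diff E_eq_divdiff)
  then have "X -` vars (f - g) = {}"
    using X_vars_bounded_if_divdiff_eq_0[of 0 "\<lambda>i. i" "f - g"] by auto
  then have "subst at_t (f - g) = f - g"
    by (rule subst_at_t_id)
  then show ?thesis
    using assms(2) by (simp add: subst_diff)
qed

section \<open>Trimming and grafting\<close>

lemma nleaves_eq: "nleaves t = Suc (size t)"
  by (induction t) auto

lemma nleaves_pos [simp]: "0 < nleaves t"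
  by (simp add: nleaves_eq)

lemma finite_qdes_tree: "finite (qdes_tree t)"
  by (induction t) auto

fun graft_tree :: "nat \<Rightarrow> tree \<Rightarrow> tree" where
  "graft_tree a Leaf = Node Leaf Leaf"
| "graft_tree a (Node l r) =
     (if a < nleaves l then Node (graft_tree a l) r else Node l (graft_tree (a - nleaves l) r))"

lemma graft_tree_neq_Leaf [simp]: "graft_tree a t \<noteq> Leaf"
  by (cases t) auto

lemma size_graft_tree [simp]: "size (graft_tree a t) = Suc (size t)"
  by (induction a t rule: graft_tree.induct) auto

lemma nleaves_graft_tree [simp]: "nleaves (graft_tree a t) = Suc (nleaves t)"
  by (simp add: nleaves_eq)

lemma qdes_tree_graft_tree: "a < nleaves t \<Longrightarrow> a \<in> qdes_tree (graft_tree a t)"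
proof (induction a t rule: graft_tree.induct)
  case (2 a l r)
  show ?case
  proof (cases "a < nleaves l")
    case False
    then have "a - nleaves l \<in> qdes_tree (graft_tree (a - nleaves l) r)"
      using 2 by simp
    then have "a \<in> (\<lambda>c. c + nleaves l) ` qdes_tree (graft_tree (a - nleaves l) r)"
      using False by (intro image_eqI[of _ _ "a - nleaves l"]) auto
    then show ?thesis
      using False by simp
  qed (use 2 in simp)
qed simp

lemma del_tree_graft_tree: "a < nleaves t \<Longrightarrow> del_tree a (graft_tree a t) = t"
  by (induction a t rule: graft_tree.induct) auto

lemma graft_tree_del_tree:
  assumes "a \<in> qdes_tree t"
  shows "a < nleaves (del_tree a t) \<and> graft_tree a (del_tree a t) = t"
  using assms
proof (induction t arbitrary: a)
  case (Node l r)
  show ?case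
  proof (cases "l = Leaf \<and> r = Leaf")
    case True
    then show ?thesis
      using Node.prems by simp
  next
    case False
    then consider "a \<in> qdes_tree l" | c where "c \<in> qdes_tree r" "a = c + nleaves l"
      using Node.prems by auto
    then show ?thesis
    proof cases
      case 1
      then have "a < nleaves (del_tree a l)" "graft_tree a (del_tree a l) = l"
        using Node.IH(1) by blast+
      moreover from this have "a < nleaves l"
        using nleaves_graft_tree[of a "del_tree a l"] by simp
      ultimately show ?thesis
        using False by auto
    next
      case 2
      then show ?thesis
        using Node.IH(2)[of c] False by auto
    qed
  qed
qed simp

lemma graft_tree_commute:
  assumes "a < b" "b < nleaves t"
  shows "graft_tree (Suc b) (graft_tree a t) = graft_tree a (graft_tree b t)"
  using assms
proof (induction t arbitrary: a b)
  case (Node l r)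
  consider "b < nleaves l" | "a < nleaves l" "nleaves l \<le> b" | "nleaves l \<le> a"
    by linarith
  then show ?case
  proof cases
    case 3
    then have "Suc (b - nleaves l) = Suc b - nleaves l"
      using Node.prems by simp
    then show ?thesis
      using 3 Node.IH(2)[of "a - nleaves l" "b - nleaves l"] Node.prems by simp
  qed (use Node in simp_all)
qed simp

lemma offset_0 [simp]: "offset F 0 = 0"
  by (simp add: offset_def)

lemma offset_Suc [simp]: "offset F (Suc k) = offset F k + nleaves (F k)"
  by (simp add: offset_def)

lemma offset_mono: "k \<le> l \<Longrightarrow> offset F k \<le> offset F l"
  by (rule lift_Suc_mono_le) auto

lemma offset_add_less_imp_le:
  assumes "offset F k + a < offset F l + b" "b < nleaves (F l)"
  shows "k \<le> l"
proof (rule ccontr)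
  assume "\<not> k \<le> l"
  then have "offset F (Suc l) \<le> offset F k"
    by (intro offset_mono) simp
  then show False
    using assms by simp
qed

lemma leaf_in_block:
  obtains k a where "i = offset F k + a" "a < nleaves (F k)"
proof -
  have "\<exists>k a. i = offset F k + a \<and> a < nleaves (F k)"
  proof (induction i)
    case 0
    show ?case
      by (intro exI[of _ 0]) simp
  next
    case (Suc i)
    then obtain k a where ka: "i = offset F k + a" "a < nleaves (F k)"
      by blast
    show ?case
    proof (cases "Suc a < nleaves (F k)")
      case True
      then show ?thesis
        using ka by (intro exI[of _ k] exI[of _ "Suc a"]) simp
    next
      case False
      then show ?thesis
        using ka by (intro exI[of _ "Suc k"] exI[of _ 0]) simp
    qed
  qed
  then show thesis
    using that by blast
qed

lemma offset_fun_upd_le: "l \<le> k \<Longrightarrow> offset (F(k := t)) l = offset F l"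
  unfolding offset_def by (rule sum.cong) auto

lemma offset_fun_upd_gt:
  assumes "k < l"
  shows "offset (F(k := t)) l + nleaves (F k) = offset F l + nleaves t"
  using assms
proof (induction l)
  case (Suc l)
  then show ?case
    using offset_fun_upd_le[of l k F t]
    by (cases "k = l") (simp_all del: fun_upd_apply add: fun_upd_same fun_upd_other)
qed simp

definition forest_apply :: "(nat \<Rightarrow> tree \<Rightarrow> tree) \<Rightarrow> forest \<Rightarrow> nat \<Rightarrow> forest" where
  "forest_apply f F i = (\<lambda>k. if offset F k \<le> i \<and> i < offset F (Suc k)
                             then f (i - offset F k) (F k) else F k)"

lemma forest_del_eq_forest_apply: "forest_del = forest_apply del_tree"
  by (simp add: fun_eq_iff forest_del_def forest_apply_def)

lemma forest_apply_block:
  assumes "i = offset F k + a" "a < nleaves (F k)"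
  shows "forest_apply f F i = F(k := f a (F k))"
proof
  fix l
  have "l = k" if "offset F l \<le> i" "i < offset F (Suc l)"
  proof (rule antisym)
    show "l \<le> k"
      using offset_mono[of "Suc k" l F] that(1) assms by (cases "l \<le> k") auto
    show "k \<le> l"
      using offset_mono[of "Suc l" k F] that(2) assms(1) by (cases "k \<le> l") auto
  qed
  then show "forest_apply f F i l = (F(k := f a (F k))) l"
    using assms by (auto simp: forest_apply_def)
qed

definition forest_graft :: "forest \<Rightarrow> nat \<Rightarrow> forest" where
  "forest_graft = forest_apply graft_tree"

lemma forest_graft_block:
  "i = offset F k + a \<Longrightarrow> a < nleaves (F k) \<Longrightarrow> forest_graft F i = F(k := graft_tree a (F k))"
  by (simp add: forest_graft_def forest_apply_block)

lemma forest_del_block: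
  "i = offset F k + a \<Longrightarrow> a < nleaves (F k) \<Longrightarrow> forest_del F i = F(k := del_tree a (F k))"
  by (simp add: forest_del_eq_forest_apply forest_apply_block)

lemma Qdes_iff: "i \<in> Qdes F \<longleftrightarrow> (\<exists>k. \<exists>a\<in>qdes_tree (F k). i = offset F k + a)"
  by (auto simp: Qdes_def add.commute)

lemma Qdes_forest_graft: "i \<in> Qdes (forest_graft F i)"
proof -
  obtain k a where i: "i = offset F k + a" "a < nleaves (F k)"
    by (rule leaf_in_block)
  have "a \<in> qdes_tree ((F(k := graft_tree a (F k))) k)"
    using i(2) by (simp add: qdes_tree_graft_tree)
  moreover have "i = offset (F(k := graft_tree a (F k))) k + a"
    using i(1) by (simp add: offset_fun_upd_le)
  ultimately show ?thesis
    unfolding forest_graft_block[OF i] Qdes_iff by blast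
qed

lemma forest_del_forest_graft: "forest_del (forest_graft F i) i = F"
proof -
  obtain k a where i: "i = offset F k + a" "a < nleaves (F k)"
    by (rule leaf_in_block)
  define G where "G = F(k := graft_tree a (F k))"
  have "i = offset G k + a" "a < nleaves (G k)"
    using i by (simp_all add: G_def offset_fun_upd_le)
  then have "forest_del G i = G(k := del_tree a (G k))"
    by (rule forest_del_block)
  also have "\<dots> = F"
    using i(2) by (simp add: G_def del_tree_graft_tree)
  finally show ?thesis
    unfolding G_def forest_graft_block[OF i] .
qed

lemma forest_graft_forest_del:
  assumes "i \<in> Qdes F"
  shows "forest_graft (forest_del F i) i = F"
proof -
  obtain k a where i: "i = offset F k + a" "a \<in> qdes_tree (F k)"
    using assms by (auto simp: Qdes_iff)
  note graft_del = graft_tree_del_tree[OF i(2)]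
  then have a: "a < nleaves (F k)"
    using nleaves_graft_tree[of a "del_tree a (F k)"] by simp
  define G where "G = F(k := del_tree a (F k))"
  have "i = offset G k + a" "a < nleaves (G k)"
    using i(1) graft_del by (simp_all add: G_def offset_fun_upd_le)
  then have "forest_graft G i = G(k := graft_tree a (G k))"
    by (rule forest_graft_block)
  also have "\<dots> = F"
    using graft_del by (simp add: G_def)
  finally show ?thesis
    unfolding G_def forest_del_block[OF i(1) a] .
qed

lemma forest_graft_twice_in_block:
  assumes "i = offset F k + a" "a < nleaves (F k)" "j = offset F k + b" "b \<le> nleaves (F k)"
  shows "forest_graft (forest_graft F i) j = F(k := graft_tree b (graft_tree a (F k)))"
proof -
  let ?G = "F(k := graft_tree a (F k))"
  have "j = offset ?G k + b" "b < nleaves (?G k)"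
    using assms(3,4) by (simp_all add: offset_fun_upd_le)
  then have "forest_graft ?G j = ?G(k := graft_tree b (?G k))"
    by (rule forest_graft_block)
  then show ?thesis
    by (simp add: forest_graft_block[OF assms(1,2)])
qed

lemma forest_graft_twice_in_distinct_blocks:
  assumes "k < l" "i = offset F k + a" "a < nleaves (F k)" "j = offset F l + b" "b < nleaves (F l)"
  shows "forest_graft (forest_graft F i) (Suc j)
      = F(k := graft_tree a (F k), l := graft_tree b (F l))" (is "_ = ?GH")
    and "forest_graft (forest_graft F j) i
      = F(k := graft_tree a (F k), l := graft_tree b (F l))"
proof -
  let ?G = "F(k := graft_tree a (F k))" and ?H = "F(l := graft_tree b (F l))"
  have "Suc j = offset ?G l + b" "b < nleaves (?G l)"
    using assms offset_fun_upd_gt[of k l F "graft_tree a (F k)"] by simp_all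
  then have "forest_graft ?G (Suc j) = ?G(l := graft_tree b (?G l))"
    by (rule forest_graft_block)
  then show "forest_graft (forest_graft F i) (Suc j) = ?GH"
    using assms(1) by (simp add: forest_graft_block[OF assms(2,3)])
  have "i = offset ?H k + a" "a < nleaves (?H k)"
    using assms by (simp_all add: offset_fun_upd_le)
  then have "forest_graft ?H i = ?H(k := graft_tree a (?H k))"
    by (rule forest_graft_block)
  then show "forest_graft (forest_graft F j) i = ?GH"
    using assms(1) by (simp add: forest_graft_block[OF assms(4,5)] fun_upd_twist)
qed

lemma forest_graft_commute:
  assumes "i < j"
  shows "forest_graft (forest_graft F i) (Suc j) = forest_graft (forest_graft F j) i"
proof -
  obtain k a where i: "i = offset F k + a" "a < nleaves (F k)"
    by (rule leaf_in_block)
  obtain l b where j: "j = offset F l + b" "b < nleaves (F l)"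
    by (rule leaf_in_block)
  have "k \<le> l"
    using assms i(1) j by (intro offset_add_less_imp_le[of F k a l b]) simp_all
  then consider "k = l" | "k < l"
    by linarith
  then show ?thesis
  proof cases
    case 1
    then have "a < b" "Suc j = offset F k + Suc b" "j = offset F k + b" "b < nleaves (F k)"
      using assms i(1) j by simp_all
    then show ?thesis
      using i by (simp add: forest_graft_twice_in_block graft_tree_commute)
  next
    case 2
    then show ?thesis
      using forest_graft_twice_in_distinct_blocks[OF 2 i j] by simp
  qed
qed

lemma Qdes_forest_del_iff:
  "i \<in> Qdes F \<and> j \<in> Qdes (forest_del F i) \<longleftrightarrow> (\<exists>G. F = forest_graft (forest_graft G j) i)"
  by (metis forest_del_forest_graft forest_graft_forest_del Qdes_forest_graft)

lemma Qdes_forest_del_commute: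
  assumes "i < j"
  shows "i \<in> Qdes F \<and> j \<in> Qdes (forest_del F i)
    \<longleftrightarrow> Suc j \<in> Qdes F \<and> i \<in> Qdes (forest_del F (Suc j))"
  using assms by (simp add: Qdes_forest_del_iff forest_graft_commute)

lemma forest_del_commute:
  assumes "i < j" "i \<in> Qdes F" "j \<in> Qdes (forest_del F i)"
  shows "forest_del (forest_del F i) j = forest_del (forest_del F (Suc j)) i"
proof -
  obtain G where "F = forest_graft (forest_graft G j) i"
    using assms(2,3) Qdes_forest_del_iff by blast
  moreover from this have "F = forest_graft (forest_graft G i) (Suc j)"
    using \<open>i < j\<close> by (simp add: forest_graft_commute)
  ultimately show ?thesis
    by (metis forest_del_forest_graft)
qed

lemma indexed_forest_del: "indexed_forest F \<Longrightarrow> indexed_forest (forest_del F i)"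
  unfolding indexed_forest_def
  by (erule rev_finite_subset) (auto simp: forest_del_def split: if_splits)

lemma finite_Qdes:
  assumes "indexed_forest F"
  shows "finite (Qdes F)"
proof -
  have "Qdes F = (\<Union>k\<in>{k. F k \<noteq> Leaf}. (\<lambda>a. a + offset F k) ` qdes_tree (F k))"
    unfolding Qdes_def by force
  then show ?thesis
    using assms by (simp add: indexed_forest_def finite_qdes_tree)
qed

definition forest_size :: "forest \<Rightarrow> nat" where
  "forest_size F = (\<Sum>k | F k \<noteq> Leaf. size (F k))"

lemma forest_size_eq_0_iff:
  assumes "indexed_forest F"
  shows "forest_size F = 0 \<longleftrightarrow> F = empty_forest"
proof -
  have "size t = 0 \<longleftrightarrow> t = Leaf" for t :: tree
    by (cases t) auto
  then show ?thesis
    using assms by (auto simp: forest_size_def indexed_forest_def empty_forest_def fun_eq_iff)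
qed

lemma forest_size_fun_upd:
  assumes "indexed_forest F"
  shows "forest_size (F(k := t)) + size (F k) = forest_size F + size t"
proof -
  let ?K = "insert k {k. F k \<noteq> Leaf}"
  have fin: "finite ?K"
    using assms by (simp add: indexed_forest_def)
  have sum_K: "forest_size G = size (G k) + (\<Sum>l\<in>?K - {k}. size (G l))"
    if "\<And>l. l \<noteq> k \<Longrightarrow> F l = Leaf \<Longrightarrow> G l = Leaf" for G
  proof -
    have "forest_size G = (\<Sum>l\<in>?K. size (G l))"
      unfolding forest_size_def by (rule sum.mono_neutral_left[OF fin]) (use that in auto)
    then show ?thesis
      using sum.remove[OF fin, of k "\<lambda>l. size (G l)"] by simp
  qed
  have "(\<Sum>l\<in>?K - {k}. size ((F(k := t)) l)) = (\<Sum>l\<in>?K - {k}. size (F l))"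
    by (rule sum.cong) auto
  then show ?thesis
    using sum_K[of F] sum_K[of "F(k := t)"] by simp
qed

lemma forest_size_forest_graft:
  assumes "indexed_forest F"
  shows "forest_size (forest_graft F i) = Suc (forest_size F)"
proof -
  obtain k a where i: "i = offset F k + a" "a < nleaves (F k)"
    by (rule leaf_in_block)
  show ?thesis
    using forest_size_fun_upd[OF assms, of k "graft_tree a (F k)"]
    by (simp add: forest_graft_block[OF i])
qed

lemma forest_size_forest_del:
  assumes "indexed_forest F" "i \<in> Qdes F"
  shows "forest_size F = Suc (forest_size (forest_del F i))"
  using forest_size_forest_graft[OF indexed_forest_del[OF assms(1)], of i i]
  by (simp add: forest_graft_forest_del assms(2))

definition trim_rel :: "(forest \<times> forest) set" where
  "trim_rel = {(G, F). indexed_forest F \<and> (\<exists>i\<in>Qdes F. G = forest_del F i)}"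

lemma forest_del_trim_rel: "indexed_forest F \<Longrightarrow> i \<in> Qdes F \<Longrightarrow> (forest_del F i, F) \<in> trim_rel"
  by (auto simp: trim_rel_def)

lemma indexed_forest_trim_rel: "(G, F) \<in> trim_rel \<Longrightarrow> indexed_forest G"
  by (auto simp: trim_rel_def indexed_forest_del)

lemma wf_trim_rel: "wf trim_rel"
  by (rule wf_subset[of "measure forest_size"]) (auto simp: trim_rel_def forest_size_forest_del)

section \<open>Double forest polynomials\<close>

definition trim_derivative :: "(forest \<Rightarrow> poly) \<Rightarrow> forest \<Rightarrow> nat \<Rightarrow> poly" where
  "trim_derivative P F i = (if i \<in> Qdes F then subst (hat_t i) (P (forest_del F i)) else 0)"

lemma trim_derivative_cong:
  assumes "indexed_forest F" and "\<And>G. (G, F) \<in> trim_rel \<Longrightarrow> P G = Q G"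
  shows "trim_derivative P F = trim_derivative Q F"
proof
  fix i
  show "trim_derivative P F i = trim_derivative Q F i"
    using assms by (simp add: trim_derivative_def forest_del_trim_rel)
qed

definition is_double_forest_poly :: "(forest \<Rightarrow> poly) \<Rightarrow> forest \<Rightarrow> poly \<Rightarrow> bool" where
  "is_double_forest_poly P F f \<longleftrightarrow> homogeneous_deg (forest_size F) f \<and>
     subst at_t f = (if F = empty_forest then 1 else 0) \<and> (\<forall>i. E i f = trim_derivative P F i)"

lemma divdiff_trim_derivative:
  assumes "i \<in> Qdes F \<Longrightarrow> E j (P (forest_del F i)) = trim_derivative P (forest_del F i) j"
  shows "divdiff j (hat_index i j) (trim_derivative P F i)
    = (if i \<in> Qdes F \<and> j \<in> Qdes (forest_del F i)
       then subst (hat_t i) (subst (hat_t j) (P (forest_del (forest_del F i) j))) else 0)"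
proof (cases "i \<in> Qdes F")
  case True
  then have "divdiff j (hat_index i j) (trim_derivative P F i)
      = subst (hat_t i) (trim_derivative P (forest_del F i) j)"
    using assms by (simp only: trim_derivative_def[of P F] if_True divdiff_hat_t E_eq_divdiff)
  then show ?thesis
    using True by (simp add: trim_derivative_def)
qed (simp add: trim_derivative_def divdiff_eq_0_iff)

lemma trim_derivative_compatible:
  assumes "i < j"
    and "\<And>i j. i \<in> Qdes F \<Longrightarrow> E j (P (forest_del F i)) = trim_derivative P (forest_del F i) j"
  shows "divdiff j (Suc j) (trim_derivative P F i) = divdiff i i (trim_derivative P F (Suc j))"
proof -
  have "divdiff j (Suc j) (trim_derivative P F i)
      = (if i \<in> Qdes F \<and> j \<in> Qdes (forest_del F i)
         then subst (hat_t i) (subst (hat_t j) (P (forest_del (forest_del F i) j))) else 0)"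
    using divdiff_trim_derivative[of i F j P] assms by (simp add: hat_index_def)
  also have "\<dots> = (if Suc j \<in> Qdes F \<and> i \<in> Qdes (forest_del F (Suc j))
         then subst (hat_t (Suc j)) (subst (hat_t i) (P (forest_del (forest_del F (Suc j)) i)))
         else 0)"
    using Qdes_forest_del_commute[OF \<open>i < j\<close>, of F] forest_del_commute[OF \<open>i < j\<close>, of F]
      hat_t_commute[of i j] \<open>i < j\<close> by auto
  also have "\<dots> = divdiff i i (trim_derivative P F (Suc j))"
    using divdiff_trim_derivative[of "Suc j" F i P] assms by (simp add: hat_index_def)
  finally show ?thesis .
qed

lemma is_double_forest_poly_exists:
  assumes F: "indexed_forest F"
    and P: "\<And>G. (G, F) \<in> trim_rel \<Longrightarrow> is_double_forest_poly P G (P G)"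
  shows "\<exists>f. is_double_forest_poly P F f"
proof (cases "F = empty_forest")
  case True
  have "Qdes F = {}"
    by (simp add: True Qdes_def empty_forest_def)
  moreover have "forest_size F = 0"
    using True F by (simp add: forest_size_eq_0_iff)
  ultimately have "is_double_forest_poly P F 1"
    using True
    by (simp add: is_double_forest_poly_def trim_derivative_def E_eq_divdiff divdiff_eq_0_iff)
  then show ?thesis ..
next
  case False
  then obtain d where d: "forest_size F = Suc d"
    using F by (metis forest_size_eq_0_iff not0_implies_Suc)
  have P_del: "is_double_forest_poly P (forest_del F i) (P (forest_del F i))"
    if "i \<in> Qdes F" for i
    using P F that by (simp add: forest_del_trim_rel)
  obtain f where "homogeneous_deg (Suc d) f" "subst at_t f = 0"
    "\<And>i. E i f = trim_derivative P F i"
  proof (rule E_integrable)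
    show "finite {i. trim_derivative P F i \<noteq> 0}"
      by (rule finite_subset[OF _ finite_Qdes[OF F]]) (auto simp: trim_derivative_def)
    show "divdiff j (Suc j) (trim_derivative P F i) = divdiff i i (trim_derivative P F (Suc j))"
      if "i < j" for i j
      using that P_del by (intro trim_derivative_compatible)
        (simp_all add: is_double_forest_poly_def)
    show "homogeneous_deg d (trim_derivative P F i)" for i
      using P_del[of i] forest_size_forest_del[OF F, of i] d
      by (simp add: trim_derivative_def is_double_forest_poly_def
          homogeneous_deg_subst[OF homogeneous_deg_hat_t])
  qed blast
  then have "is_double_forest_poly P F f"
    using False d by (simp add: is_double_forest_poly_def)
  then show ?thesis ..
qed

lemma double_forest_polys_exist:
  "\<exists>P. \<forall>F. indexed_forest F \<longrightarrow> is_double_forest_poly P F (P F)"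
proof (rule dependent_wf_choice[OF wf_trim_rel])
  show "(indexed_forest F \<longrightarrow> is_double_forest_poly P F f)
      = (indexed_forest F \<longrightarrow> is_double_forest_poly Q F f)"
    if "\<And>G. (G, F) \<in> trim_rel \<Longrightarrow> P G = Q G" for P Q F f
    using trim_derivative_cong[of F P Q] that by (auto simp: is_double_forest_poly_def)
  show "\<exists>f. indexed_forest F \<longrightarrow> is_double_forest_poly P F f"
    if "\<And>G. (G, F) \<in> trim_rel \<Longrightarrow> indexed_forest G \<longrightarrow> is_double_forest_poly P G (P G)" for F P
    using that is_double_forest_poly_exists[of F P] indexed_forest_trim_rel by blast
qed

lemma double_forest_polys_unique:
  assumes "\<And>F. indexed_forest F \<Longrightarrow> subst at_t (P F) = subst at_t (Q F)"
    and "\<And>F i. indexed_forest F \<Longrightarrow> E i (P F) = trim_derivative P F i"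
    and "\<And>F i. indexed_forest F \<Longrightarrow> E i (Q F) = trim_derivative Q F i"
    and "indexed_forest F"
  shows "P F = Q F"
  using wf_trim_rel \<open>indexed_forest F\<close>
proof (induction F rule: wf_induct_rule)
  case (less F)
  have "P G = Q G" if "(G, F) \<in> trim_rel" for G
    using that less.IH indexed_forest_trim_rel by blast
  then have "trim_derivative P F = trim_derivative Q F"
    by (rule trim_derivative_cong[OF less.prems])
  then show ?case
    using assms(1-3) less.prems eq_if_E_eq by metis
qed

theorem theorem4p2:
  shows "\<exists>P :: forest \<Rightarrow> poly.
    (\<forall>F. indexed_forest F \<longrightarrow>
        homogeneous (P F) \<and>
        subst at_t (P F) = (if F = empty_forest then 1 else 0) \<and>
        (\<forall>i. E i (P F) = (if i \<in> Qdes F then subst (hat_t i) (P (forest_del F i)) else 0))) \<and>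
    (\<forall>Q :: forest \<Rightarrow> poly.
      (\<forall>F. indexed_forest F \<longrightarrow>
        homogeneous (Q F) \<and>
        subst at_t (Q F) = (if F = empty_forest then 1 else 0) \<and>
        (\<forall>i. E i (Q F) = (if i \<in> Qdes F then subst (hat_t i) (Q (forest_del F i)) else 0)))
      \<longrightarrow> (\<forall>F. indexed_forest F \<longrightarrow> Q F = P F))"
proof -
  obtain P where P: "\<And>F. indexed_forest F \<Longrightarrow> is_double_forest_poly P F (P F)"
    using double_forest_polys_exist by blast
  show ?thesis
  proof (intro exI[of _ P] conjI allI impI)
    fix F i assume F: "indexed_forest F"
    show "homogeneous (P F)"
      using P[OF F] by (auto simp: is_double_forest_poly_def homogeneous_iff)
    show "subst at_t (P F) = (if F = empty_forest then 1 else 0)"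
      and "E i (P F) = (if i \<in> Qdes F then subst (hat_t i) (P (forest_del F i)) else 0)"
      using P[OF F] by (simp_all add: is_double_forest_poly_def trim_derivative_def)
  next
    fix Q F
    assume Q: "\<forall>F. indexed_forest F \<longrightarrow> homogeneous (Q F) \<and>
        subst at_t (Q F) = (if F = empty_forest then 1 else 0) \<and>
        (\<forall>i. E i (Q F) = (if i \<in> Qdes F then subst (hat_t i) (Q (forest_del F i)) else 0))"
      and F: "indexed_forest F"
    from Q P F show "Q F = P F"
      by (intro double_forest_polys_unique[of Q P F])
        (simp_all add: is_double_forest_poly_def trim_derivative_def)
  qed
qed

end
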